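(* Let $S$ be a finite approximation space, $Q=\wp(S)/{\approx}$ the associated pre-rough algebra of roughly equal objects, and $K\subseteq Q$ an L-filter. Define partial operations on $Q$ by: $x\Cup y=x\sqcup y$ if $x\sqcup y\in K$ and undefined otherwise; $x\Cap y=x\sqcap y$ if $x\sqcap y\in K$ and undefined otherwise. Let $x\lhd y$ iff $x=y$, or $x\Cap y=x$, or $x\Cup y=y$ (where the last two alternatives require the left-hand side to be defined). Then $\lhd$ is a partial order on $Q$, it is compatible with $L$ and $U$ (i.e., $x\lhd y$ implies $Lx\lhd Ly$ and $Ux\lhd Uy$), and the restriction of $\lhd$ to $K$ is the restriction of $\leq$ to $K$ (a join-semilattice order). Moreover $\lhd$ is not necessarily a lattice order on $Q$: there exist $S$ and $K$ for which it is not.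
   Context: An approximation space is a set $S$ with an equivalence relation $R$. For $A\subseteq S$, $A^{l}$ is the union of the $R$-classes contained in $A$ and $A^{u}$ is the union of the $R$-classes meeting $A$. Sets $A,B\subseteq S$ are roughly equal, $A\approx B$, iff $A^{l}=B^{l}$ and $A^{u}=B^{u}$. On $Q=\wp(S)/{\approx}$ the rough inclusion order is $[A]\leq[B]$ iff $A^{l}\subseteq B^{l}$ and $A^{u}\subseteq B^{u}$; this is a distributive lattice order, with join $\sqcup$ and meet $\sqcap$, least element $0=[\emptyset]$ and greatest element $1=[S]$. The unary operations are $L[A]=[A^{l}]$, $U[A]=[A^{u}]$, $\neg[A]=[S\setminus A]$. A nonempty subset $K\subseteq Q$ is an L-filter iff: (F0) for all $x\in K$ and $y\in Q$, $x\leq y$ implies $y\in K$; and (O1) for all $x\in K$, $Lx\in K$. *)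

theory Defs
  imports "HOL-Algebra.Lattice"
begin

definition lower_approx :: "'a set \<Rightarrow> ('a \<times> 'a) set \<Rightarrow> 'a set \<Rightarrow> 'a set" where
  "lower_approx S R A = \<Union>{C \<in> S // R. C \<subseteq> A}"

definition upper_approx :: "'a set \<Rightarrow> ('a \<times> 'a) set \<Rightarrow> 'a set \<Rightarrow> 'a set" where
  "upper_approx S R A = \<Union>{C \<in> S // R. C \<inter> A \<noteq> {}}"

definition rough_eq :: "'a set \<Rightarrow> ('a \<times> 'a) set \<Rightarrow> ('a set \<times> 'a set) set" where
  "rough_eq S R = {(A, B). A \<subseteq> S \<and> B \<subseteq> S \<and>
     lower_approx S R A = lower_approx S R B \<and> upper_approx S R A = upper_approx S R B}"

definition rough_objects :: "'a set \<Rightarrow> ('a \<times> 'a) set \<Rightarrow> 'a set set set" where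
  "rough_objects S R = Pow S // rough_eq S R"

text \<open>Rough objects are classes of subsets, so the rough inclusion order and the operations
  \<open>L\<close> and \<open>U\<close> are defined through representatives; independence of the choice is shown below.\<close>

definition rough_le :: "'a set \<Rightarrow> ('a \<times> 'a) set \<Rightarrow> 'a set set \<Rightarrow> 'a set set \<Rightarrow> bool" where
  "rough_le S R x y \<longleftrightarrow> (\<exists>A\<in>x. \<exists>B\<in>y.
     lower_approx S R A \<subseteq> lower_approx S R B \<and> upper_approx S R A \<subseteq> upper_approx S R B)"

definition rough_L :: "'a set \<Rightarrow> ('a \<times> 'a) set \<Rightarrow> 'a set set \<Rightarrow> 'a set set" where
  "rough_L S R x = (\<Union>A\<in>x. rough_eq S R `` {lower_approx S R A})"

definition rough_U :: "'a set \<Rightarrow> ('a \<times> 'a) set \<Rightarrow> 'a set set \<Rightarrow> 'a set set" where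
  "rough_U S R x = (\<Union>A\<in>x. rough_eq S R `` {upper_approx S R A})"

definition rough_order :: "'a set \<Rightarrow> ('a \<times> 'a) set \<Rightarrow> 'a set set gorder" where
  "rough_order S R = \<lparr>carrier = rough_objects S R, eq = (=), le = rough_le S R\<rparr>"

definition L_filter :: "'a set \<Rightarrow> ('a \<times> 'a) set \<Rightarrow> 'a set set set \<Rightarrow> bool" where
  "L_filter S R K \<longleftrightarrow> K \<subseteq> rough_objects S R \<and> K \<noteq> {} \<and>
     (\<forall>x\<in>K. \<forall>y\<in>rough_objects S R. rough_le S R x y \<longrightarrow> y \<in> K) \<and>
     (\<forall>x\<in>K. rough_L S R x \<in> K)"

text \<open>The partial operations return \<open>None\<close> where they are undefined.\<close>

definition pjoin ::
  "'a set \<Rightarrow> ('a \<times> 'a) set \<Rightarrow> 'a set set set \<Rightarrow> 'a set set \<Rightarrow> 'a set set \<Rightarrow> 'a set set option" where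
  "pjoin S R K x y = (let z = x \<squnion>\<^bsub>rough_order S R\<^esub> y in if z \<in> K then Some z else None)"

definition pmeet ::
  "'a set \<Rightarrow> ('a \<times> 'a) set \<Rightarrow> 'a set set set \<Rightarrow> 'a set set \<Rightarrow> 'a set set \<Rightarrow> 'a set set option" where
  "pmeet S R K x y = (let z = x \<sqinter>\<^bsub>rough_order S R\<^esub> y in if z \<in> K then Some z else None)"

definition lhd ::
  "'a set \<Rightarrow> ('a \<times> 'a) set \<Rightarrow> 'a set set set \<Rightarrow> 'a set set \<Rightarrow> 'a set set \<Rightarrow> bool" where
  "lhd S R K x y \<longleftrightarrow> x = y \<or> pmeet S R K x y = Some x \<or> pjoin S R K x y = Some y"

definition lhd_order ::
  "'a set \<Rightarrow> ('a \<times> 'a) set \<Rightarrow> 'a set set set \<Rightarrow> 'a set set gorder" where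
  "lhd_order S R K = \<lparr>carrier = rough_objects S R, eq = (=), le = lhd S R K\<rparr>"

lemma equiv_rough_eq: "equiv (Pow S) (rough_eq S R)"
  by (rule equivI) (auto simp: rough_eq_def refl_on_def sym_def trans_def)

lemma rough_le_class:
  assumes "A \<subseteq> S" and "B \<subseteq> S"
  shows "rough_le S R (rough_eq S R `` {A}) (rough_eq S R `` {B}) \<longleftrightarrow>
    lower_approx S R A \<subseteq> lower_approx S R B \<and> upper_approx S R A \<subseteq> upper_approx S R B"
  using assms by (auto simp: rough_le_def rough_eq_def)

lemma rough_L_class:
  assumes "A \<subseteq> S"
  shows "rough_L S R (rough_eq S R `` {A}) = rough_eq S R `` {lower_approx S R A}"
  using assms by (auto simp: rough_L_def rough_eq_def)

lemma rough_U_class: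
  assumes "A \<subseteq> S"
  shows "rough_U S R (rough_eq S R `` {A}) = rough_eq S R `` {upper_approx S R A}"
  using assms by (auto simp: rough_U_def rough_eq_def)

lemma mem_approx:
  assumes "equiv S R"
  shows "a \<in> lower_approx S R A \<longleftrightarrow> a \<in> S \<and> R `` {a} \<subseteq> A"
    and "a \<in> upper_approx S R A \<longleftrightarrow> a \<in> S \<and> R `` {a} \<inter> A \<noteq> {}"
proof -
  have "C = R `` {a}" if "C \<in> S // R" "a \<in> C" for C
    using that assms by (metis Image_singleton_iff equiv_class_eq quotientE)
  moreover have "a \<in> R `` {a}" "R `` {a} \<in> S // R" if "a \<in> S"
    using that assms equiv_class_self[of S R a] quotientI[of a S R] by blast+
  moreover have "a \<in> S" if "C \<in> S // R" "a \<in> C" for C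
    using that assms in_quotient_imp_subset by fastforce
  ultimately show "a \<in> lower_approx S R A \<longleftrightarrow> a \<in> S \<and> R `` {a} \<subseteq> A"
    and "a \<in> upper_approx S R A \<longleftrightarrow> a \<in> S \<and> R `` {a} \<inter> A \<noteq> {}"
    unfolding lower_approx_def upper_approx_def by blast+
qed

text \<open>The join and meet of two rough objects exist, so the choice operator in the library's
  \<open>join\<close> and \<open>meet\<close> picks the actual supremum and infimum.\<close>

lemma lattice_rough_order:
  assumes eqv: "equiv S R"
  shows "lattice (rough_order S R)"
proof -
  let ?l = "lower_approx S R" and ?u = "upper_approx S R" and ?c = "\<lambda>A. rough_eq S R `` {A}"
  have self: "a \<in> R `` {a}" if "a \<in> S" for a using eqv that by (rule equiv_class_self)
  have same: "R `` {b} = R `` {a}" if "b \<in> R `` {a}" for a b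
    using eqv that by (metis Image_singleton_iff equiv_class_eq)
  have sub: "R `` {a} \<subseteq> S" for a using eqv by (auto simp: equiv_def)
  have obj: "\<exists>A. A \<subseteq> S \<and> x = ?c A" if "x \<in> rough_objects S R" for x
    using that unfolding rough_objects_def by (auto elim!: quotientE)
  have cls: "?c A \<in> rough_objects S R" if "A \<subseteq> S" for A
    using that by (auto simp: rough_objects_def intro: quotientI)
  have eqI: "?c A = ?c B" if "A \<subseteq> S" "B \<subseteq> S" "?l A = ?l B" "?u A = ?u B" for A B
    using that by (auto simp: rough_eq_def)
  have po: "partial_order (rough_order S R)"
  proof (unfold_locales; (simp add: rough_order_def)?)
    show "rough_le S R x x" if "x \<in> rough_objects S R" for x
      using obj[OF that] by (auto simp: rough_le_class)
    show "x = y" if "rough_le S R x y" "rough_le S R y x"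
      "x \<in> rough_objects S R" "y \<in> rough_objects S R" for x y
      using obj[OF that(3)] obj[OF that(4)] that(1,2)
      by (metis eqI rough_le_class subset_antisym)
    show "rough_le S R x z" if "rough_le S R x y" "rough_le S R y z"
      "x \<in> rough_objects S R" "y \<in> rough_objects S R" "z \<in> rough_objects S R" for x y z
      using obj[OF that(3)] obj[OF that(4)] obj[OF that(5)] that(1,2)
      by (metis rough_le_class subset_trans)
  qed
  have sup: "\<exists>C\<subseteq>S. ?l C = ?l A \<union> ?l B \<and> ?u C = ?u A \<union> ?u B" if "A \<subseteq> S" "B \<subseteq> S" for A B
  proof (intro exI conjI)
    let ?C = "A \<union> (B - ?u A) \<union> ?l B"
    show "?C \<subseteq> S" using that by (auto simp: mem_approx[OF eqv])
    have l: "R `` {a} \<subseteq> ?C \<longleftrightarrow> R `` {a} \<subseteq> A \<or> R `` {a} \<subseteq> B" if "a \<in> S" for a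
    proof (cases "R `` {a} \<inter> A = {}")
      case True
      then have "b \<notin> ?u A" if "b \<in> R `` {a}" for b
        using same[OF that] by (simp add: mem_approx[OF eqv])
      moreover have "b \<in> B" if "b \<in> ?l B" for b
        using that self by (auto simp: mem_approx[OF eqv])
      ultimately show ?thesis using True by blast
    next
      case False
      then have "b \<in> ?u A" if "b \<in> R `` {a}" for b
        using same[OF that] that sub by (auto simp: mem_approx[OF eqv])
      moreover have "b \<in> ?l B \<longleftrightarrow> R `` {a} \<subseteq> B" if "b \<in> R `` {a}" for b
        using same[OF that] that sub by (auto simp: mem_approx[OF eqv])
      ultimately show ?thesis by blast
    qed
    show "?l ?C = ?l A \<union> ?l B"
    proof (rule Set.set_eqI)
      fix a
      show "a \<in> ?l ?C \<longleftrightarrow> a \<in> ?l A \<union> ?l B"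
        unfolding Un_iff[of a] mem_approx(1)[OF eqv, of a] using l[of a] by blast
    qed
    have u: "R `` {a} \<inter> ?C \<noteq> {} \<longleftrightarrow> R `` {a} \<inter> A \<noteq> {} \<or> R `` {a} \<inter> B \<noteq> {}" if "a \<in> S" for a
    proof -
      have "b \<in> ?u A \<longleftrightarrow> R `` {a} \<inter> A \<noteq> {}" if "b \<in> R `` {a}" for b
        using same[OF that] that sub by (auto simp: mem_approx[OF eqv])
      moreover have "b \<in> B" if "b \<in> ?l B" for b
        using that self by (auto simp: mem_approx[OF eqv])
      ultimately show ?thesis by blast
    qed
    show "?u ?C = ?u A \<union> ?u B"
    proof (rule Set.set_eqI)
      fix a
      show "a \<in> ?u ?C \<longleftrightarrow> a \<in> ?u A \<union> ?u B"
        unfolding Un_iff[of a] mem_approx(2)[OF eqv, of a] using u[of a] by blast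
    qed
  qed
  have compl: "?l (S - A) = S - ?u A" "?u (S - A) = S - ?l A" for A
    using sub by (auto simp: set_eq_iff mem_approx[OF eqv])
  have appS: "?l A \<subseteq> S" "?u A \<subseteq> S" for A by (auto simp: mem_approx[OF eqv])
  have inf: "\<exists>C\<subseteq>S. ?l C = ?l A \<inter> ?l B \<and> ?u C = ?u A \<inter> ?u B" for A B
  proof -
    obtain C where "C \<subseteq> S" "?l C = ?l (S - A) \<union> ?l (S - B)" "?u C = ?u (S - A) \<union> ?u (S - B)"
      using sup[of "S - A" "S - B"] by auto
    then show ?thesis using appS[of A] appS[of B]
      by (intro exI[of _ "S - C"]) (auto simp: compl)
  qed
  have lub: "\<exists>s. least (rough_order S R) s (Upper (rough_order S R) {x, y})"
    if xy: "x \<in> rough_objects S R" "y \<in> rough_objects S R" for x y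
  proof -
    obtain A B where A: "A \<subseteq> S" "x = ?c A" and B: "B \<subseteq> S" "y = ?c B"
      using obj[OF xy(1)] obj[OF xy(2)] by blast
    obtain C where C: "C \<subseteq> S" "?l C = ?l A \<union> ?l B" "?u C = ?u A \<union> ?u B"
      using sup[OF A(1) B(1)] by blast
    have "rough_le S R (?c C) z" if z: "z \<in> rough_objects S R"
      "rough_le S R x z" "rough_le S R y z" for z
      using obj[OF z(1)] z(2,3) A B C by (auto simp: rough_le_class)
    then have "least (rough_order S R) (?c C) (Upper (rough_order S R) {x, y})"
      using A B C cls by (auto simp: least_def Upper_def rough_order_def rough_le_class)
    then show ?thesis ..
  qed
  have glb: "\<exists>s. greatest (rough_order S R) s (Lower (rough_order S R) {x, y})"
    if xy: "x \<in> rough_objects S R" "y \<in> rough_objects S R" for x y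
  proof -
    obtain A B where A: "A \<subseteq> S" "x = ?c A" and B: "B \<subseteq> S" "y = ?c B"
      using obj[OF xy(1)] obj[OF xy(2)] by blast
    obtain C where C: "C \<subseteq> S" "?l C = ?l A \<inter> ?l B" "?u C = ?u A \<inter> ?u B"
      using inf by blast
    have "rough_le S R z (?c C)" if z: "z \<in> rough_objects S R"
      "rough_le S R z x" "rough_le S R z y" for z
      using obj[OF z(1)] z(2,3) A B C by (auto simp: rough_le_class)
    then have "greatest (rough_order S R) (?c C) (Lower (rough_order S R) {x, y})"
      using A B C cls by (auto simp: greatest_def Lower_def rough_order_def rough_le_class)
    then show ?thesis ..
  qed
  interpret partial_order "rough_order S R" by (rule po)
  show ?thesis
    by unfold_locales (use lub glb in \<open>auto simp: rough_order_def\<close>)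
qed

end

theory Submission
  imports Defs
begin

text \<open>Since an L-filter \<open>K\<close> is an up-set, \<open>x \<lhd> y\<close> amounts to \<open>x = y\<close>, or \<open>x \<le> y\<close> with
  \<open>y \<in> K\<close>; the positive claims follow from this description, as \<open>L\<close> and \<open>U\<close> are monotone and
  map \<open>K\<close> into itself. For \<open>K = {1}\<close> every object other than \<open>1\<close> is \<open>\<lhd>\<close>-minimal,
  so two of them have no common lower bound.\<close>

lemma rough_objects_E:
  assumes "x \<in> rough_objects S R"
  obtains A where "A \<subseteq> S" "x = rough_eq S R `` {A}"
  using assms unfolding rough_objects_def by (auto elim!: quotientE)

lemma rough_class_in_objects: "A \<subseteq> S \<Longrightarrow> rough_eq S R `` {A} \<in> rough_objects S R"
  by (auto simp: rough_objects_def intro: quotientI)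

context
  fixes S :: "'a set" and R :: "('a \<times> 'a) set"
  assumes eqv: "equiv S R"
begin

text \<open>The rewrites state the imported lattice facts directly over
  \<open>rough_objects S R\<close>, \<open>rough_le S R\<close> and genuine equality.\<close>

interpretation Q: lattice "rough_order S R"
  rewrites "carrier (rough_order S R) = rough_objects S R"
    and "le (rough_order S R) = rough_le S R"
    and "eq (rough_order S R) = (=)"
  by (rule lattice_rough_order[OF eqv]) (simp_all add: rough_order_def)

lemma approx_subset: "lower_approx S R A \<subseteq> S" "upper_approx S R A \<subseteq> S"
  by (auto simp: mem_approx[OF eqv])

lemma self_in_class: "a \<in> S \<Longrightarrow> a \<in> R `` {a}"
  using eqv by (rule equiv_class_self)

lemma approx_mono:
  assumes "A \<subseteq> B"
  shows "lower_approx S R A \<subseteq> lower_approx S R B" "upper_approx S R A \<subseteq> upper_approx S R B"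
  using assms unfolding lower_approx_def upper_approx_def by blast+

lemma subset_upper_approx: "A \<subseteq> S \<Longrightarrow> A \<subseteq> upper_approx S R A"
  using self_in_class unfolding mem_approx[OF eqv] subset_iff by blast

lemma rough_L_closed: "x \<in> rough_objects S R \<Longrightarrow> rough_L S R x \<in> rough_objects S R"
  by (metis approx_subset(1) rough_L_class rough_class_in_objects rough_objects_E)

lemma rough_U_closed: "x \<in> rough_objects S R \<Longrightarrow> rough_U S R x \<in> rough_objects S R"
  by (metis approx_subset(2) rough_U_class rough_class_in_objects rough_objects_E)

text \<open>On representatives A and B the claim compares both approximations of the lower
  approximations of A and B. Both are monotone in the set, so the inclusion between the lower
  approximations suffices.\<close>

lemma rough_L_mono:
  assumes "x \<in> rough_objects S R" "y \<in> rough_objects S R" "rough_le S R x y"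
  shows "rough_le S R (rough_L S R x) (rough_L S R y)"
  using assms
  by (auto elim!: rough_objects_E simp: rough_L_class rough_le_class approx_subset approx_mono)

lemma rough_U_mono:
  assumes "x \<in> rough_objects S R" "y \<in> rough_objects S R" "rough_le S R x y"
  shows "rough_le S R (rough_U S R x) (rough_U S R y)"
  using assms
  by (auto elim!: rough_objects_E simp: rough_U_class rough_le_class approx_subset approx_mono)

text \<open>Combined with (F0), this closes every L-filter under U, for which the definition has no
  clause of its own.\<close>

lemma rough_le_U:
  assumes "x \<in> rough_objects S R"
  shows "rough_le S R x (rough_U S R x)"
  using assms
  by (auto elim!: rough_objects_E
      simp: rough_U_class rough_le_class approx_subset approx_mono subset_upper_approx)

lemma lhd_iff:
  assumes K: "L_filter S R K" and x: "x \<in> rough_objects S R" and y: "y \<in> rough_objects S R"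
  shows "lhd S R K x y \<longleftrightarrow> x = y \<or> rough_le S R x y \<and> y \<in> K"
proof -
  have "x \<squnion>\<^bsub>rough_order S R\<^esub> y = y \<longleftrightarrow> rough_le S R x y"
    using Q.le_iff_meet[OF x y] by simp
  moreover have "x \<sqinter>\<^bsub>rough_order S R\<^esub> y = x \<longleftrightarrow> rough_le S R x y"
    using Q.le_iff_join[OF x y] by auto
  \<comment> \<open>The alternative with the meet demands that x lies in K, the one with the join
    that y does. By (F0) the former implies the latter, so both collapse to one condition.\<close>
  moreover have "y \<in> K" if "x \<in> K" "rough_le S R x y"
    using K that y by (auto simp: L_filter_def)
  ultimately show ?thesis
    by (auto simp: lhd_def pjoin_def pmeet_def Let_def)
qed

lemma partial_order_lhd_order:
  assumes K: "L_filter S R K"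
  shows "partial_order (lhd_order S R K)"
proof (unfold_locales; (simp add: lhd_order_def)?)
  show "lhd S R K x x" for x by (simp add: lhd_def)
  show "x = y" if "lhd S R K x y" "lhd S R K y x"
    "x \<in> rough_objects S R" "y \<in> rough_objects S R" for x y
    using that Q.le_antisym[of x y] lhd_iff[OF K] by metis
  show "lhd S R K x z" if "lhd S R K x y" "lhd S R K y z"
    "x \<in> rough_objects S R" "y \<in> rough_objects S R" "z \<in> rough_objects S R" for x y z
    using that by (auto simp: lhd_iff[OF K] intro: Q.le_trans)
qed

text \<open>Monotonicity of L gives the inequality, and (O1) carries the condition on y over to
  \<open>rough_L S R y\<close>.\<close>

lemma lhd_rough_L:
  assumes K: "L_filter S R K" and "x \<in> rough_objects S R" "y \<in> rough_objects S R"
    and "lhd S R K x y"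
  shows "lhd S R K (rough_L S R x) (rough_L S R y)"
  using assms rough_L_mono[of x y] by (auto simp: lhd_iff rough_L_closed L_filter_def)

lemma lhd_rough_U:
  assumes K: "L_filter S R K" and x: "x \<in> rough_objects S R" and y: "y \<in> rough_objects S R"
    and "lhd S R K x y"
  shows "lhd S R K (rough_U S R x) (rough_U S R y)"
proof -
  have "rough_U S R y \<in> K" if "y \<in> K"
    using K that rough_le_U[OF y] rough_U_closed[OF y] by (auto simp: L_filter_def)
  then show ?thesis
    using assms rough_U_mono[of x y] by (auto simp: lhd_iff rough_U_closed)
qed

lemma lhd_iff_rough_le_on_filter:
  assumes K: "L_filter S R K" and "x \<in> K" "y \<in> K"
  shows "lhd S R K x y \<longleftrightarrow> rough_le S R x y"
proof -
  have "x \<in> rough_objects S R" "y \<in> rough_objects S R"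
    using assms by (auto simp: L_filter_def)
  then show ?thesis using assms by (auto simp: lhd_iff)
qed

text \<open>The join taken in Q lies above x, hence in K by (F0), and it remains least among the
  fewer upper bounds that K offers. Meets can leave K, as an L-filter need not be closed under
  them.\<close>

lemma upper_semilattice_lhd_on_filter:
  assumes K: "L_filter S R K"
  shows "upper_semilattice \<lparr>carrier = K, eq = (=), le = lhd S R K\<rparr>" (is "upper_semilattice ?P")
proof -
  have sub: "K \<subseteq> rough_objects S R" using K by (simp add: L_filter_def)
  interpret P: partial_order ?P
  proof (unfold_locales; (simp add: lhd_iff_rough_le_on_filter[OF K])?)
    show "rough_le S R x x" if "x \<in> K" for x using that sub by auto
    show "x = y" if "rough_le S R x y" "rough_le S R y x" "x \<in> K" "y \<in> K" for x y
      using that sub Q.le_antisym[of x y] by blast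
    show "rough_le S R x z" if "rough_le S R x y" "rough_le S R y z" "x \<in> K" "y \<in> K" "z \<in> K"
      for x y z
      using that sub by (meson Q.le_trans subsetD)
  qed
  show ?thesis
  proof
    fix x y assume "x \<in> carrier ?P" "y \<in> carrier ?P"
    then have xy: "x \<in> K" "y \<in> K" by simp_all
    then have obj: "x \<in> rough_objects S R" "y \<in> rough_objects S R" using sub by auto
    let ?j = "x \<squnion>\<^bsub>rough_order S R\<^esub> y"
    have j: "?j \<in> K"
      using K xy Q.join_left[OF obj] Q.join_closed[OF obj] by (auto simp: L_filter_def)
    have "rough_le S R ?j z" if "z \<in> K" "rough_le S R x z" "rough_le S R y z" for z
      using that sub obj by (intro Q.join_le) auto
    then have "least ?P ?j (Upper ?P {x, y})"
      using xy j Q.join_left[OF obj] Q.join_right[OF obj]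
      by (auto simp: least_def Upper_def lhd_iff_rough_le_on_filter[OF K])
    then show "\<exists>s. least ?P s (Upper ?P {x, y})" ..
  qed
qed

text \<open>Nothing lies strictly above the class of S, which gives (F0). Every R-class is contained
  in S, so L fixes the class of S, which gives (O1).\<close>

lemma L_filter_top: "L_filter S R {rough_eq S R `` {S}}"
proof -
  let ?top = "rough_eq S R `` {S}"
  have l: "lower_approx S R S = S"
    using eqv by (auto simp: mem_approx[OF eqv] equiv_def)
  have "y = ?top" if "y \<in> rough_objects S R" "rough_le S R ?top y" for y
  proof (rule Q.le_antisym[OF _ that(2) that(1)])
    show "rough_le S R y ?top"
      using that(1) by (auto elim!: rough_objects_E simp: rough_le_class approx_mono)
    show "?top \<in> rough_objects S R" by (simp add: rough_class_in_objects)
  qed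
  then show ?thesis
    by (auto simp: L_filter_def rough_class_in_objects rough_L_class l)
qed

lemma not_lattice_lhd_top:
  fixes x y :: "'a set set"
  defines "K \<equiv> {rough_eq S R `` {S}}"
  assumes Q: "x \<in> rough_objects S R" "y \<in> rough_objects S R"
    and "x \<notin> K" "y \<notin> K" "x \<noteq> y"
  shows "\<not> lattice (lhd_order S R K)"
proof
  assume "lattice (lhd_order S R K)"
  then interpret lattice "lhd_order S R K" .
  have K: "L_filter S R K" unfolding K_def by (rule L_filter_top)
  \<comment> \<open>An infimum would be a common lower bound s. As x and y lie outside K,
    \<open>lhd_iff\<close> leaves only s = x and s = y, against their distinctness.\<close>
  obtain s where "s \<in> rough_objects S R" "lhd S R K s x" "lhd S R K s y"
    using inf_of_two_exists[of x y] Q by (auto simp: greatest_def Lower_def lhd_order_def)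
  then show False using lhd_iff[OF K] assms(2-) by metis
qed

end

text \<open>The counterexample lives over \<open>nat\<close> because the type variable may stand for
  a one-element type, over which \<lhd> is always a lattice order.\<close>

theorem proposition13:
  shows "(\<forall>(S :: 'a set) R K. finite S \<and> equiv S R \<and> L_filter S R K \<longrightarrow>
            partial_order (lhd_order S R K) \<and>
            (\<forall>x\<in>rough_objects S R. \<forall>y\<in>rough_objects S R. lhd S R K x y \<longrightarrow>
               lhd S R K (rough_L S R x) (rough_L S R y) \<and>
               lhd S R K (rough_U S R x) (rough_U S R y)) \<and>
            (\<forall>x\<in>K. \<forall>y\<in>K. lhd S R K x y \<longleftrightarrow> rough_le S R x y) \<and>
            upper_semilattice \<lparr>carrier = K, eq = (=), le = lhd S R K\<rparr>) \<and>
         (\<exists>(S :: nat set) R K. finite S \<and> equiv S R \<and> L_filter S R K \<and>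
            \<not> lattice (lhd_order S R K))"
proof (rule conjI)
  show "\<forall>(S :: 'a set) R K. finite S \<and> equiv S R \<and> L_filter S R K \<longrightarrow>
      partial_order (lhd_order S R K) \<and>
      (\<forall>x\<in>rough_objects S R. \<forall>y\<in>rough_objects S R. lhd S R K x y \<longrightarrow>
         lhd S R K (rough_L S R x) (rough_L S R y) \<and>
         lhd S R K (rough_U S R x) (rough_U S R y)) \<and>
      (\<forall>x\<in>K. \<forall>y\<in>K. lhd S R K x y \<longleftrightarrow> rough_le S R x y) \<and>
      upper_semilattice \<lparr>carrier = K, eq = (=), le = lhd S R K\<rparr>"
    by (simp add: partial_order_lhd_order lhd_rough_L lhd_rough_U
        upper_semilattice_lhd_on_filter lhd_iff_rough_le_on_filter)
next
  \<comment> \<open>In the discrete space on two points rough equality is equality of sets, so Q is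
    a copy of the power set. The two singletons give distinct objects different from 1.\<close>
  define S :: "nat set" where "S = {0, 1}"
  define R where "R = Id_on S"
  have eqv: "equiv S R"
    by (rule equivI) (auto simp: R_def refl_on_def sym_def trans_def)
  have low: "lower_approx S R A = A" if "A \<subseteq> S" for A
  proof (rule Set.set_eqI)
    fix a show "a \<in> lower_approx S R A \<longleftrightarrow> a \<in> A"
      unfolding mem_approx(1)[OF eqv] using that by (auto simp: R_def)
  qed
  \<comment> \<open>Roughly equal sets share their lower approximation, and by \<open>low\<close>
    each set is its own.\<close>
  have inj: "rough_eq S R `` {A} = rough_eq S R `` {B} \<longleftrightarrow> A = B"
    if "A \<subseteq> S" "B \<subseteq> S" for A B
  proof
    assume "rough_eq S R `` {A} = rough_eq S R `` {B}"
    then have "(A, B) \<in> rough_eq S R"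
      using that eq_equiv_class_iff[OF equiv_rough_eq] by (metis PowI)
    then have "lower_approx S R A = lower_approx S R B" by (simp add: rough_eq_def)
    then show "A = B" using that low by metis
  qed simp
  have sub: "{0} \<subseteq> S" "{1} \<subseteq> S" and neq: "{0} \<noteq> S" "{1} \<noteq> S" by (auto simp: S_def)
  have "\<not> lattice (lhd_order S R {rough_eq S R `` {S}})"
  proof (rule not_lattice_lhd_top[OF eqv])
    show "rough_eq S R `` {{0}} \<in> rough_objects S R" "rough_eq S R `` {{1}} \<in> rough_objects S R"
      by (simp_all only: rough_class_in_objects sub)
    show "rough_eq S R `` {{0}} \<notin> {rough_eq S R `` {S}}"
      "rough_eq S R `` {{1}} \<notin> {rough_eq S R `` {S}}"
      by (simp_all only: singleton_iff inj sub neq subset_refl not_False_eq_True)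
    show "rough_eq S R `` {{0}} \<noteq> rough_eq S R `` {{1}}"
      using inj[OF sub] by simp
  qed
  moreover have "finite S" by (simp add: S_def)
  ultimately show "\<exists>(S :: nat set) R K. finite S \<and> equiv S R \<and> L_filter S R K \<and>
      \<not> lattice (lhd_order S R K)"
    using eqv L_filter_top[OF eqv] by blast
qed

end
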